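(* For every finite or infinite sequence $\mathbf f$ over $\{-1,1\}$, the run-length sequence $R_{\mathbf f}$ is overlap-free, i.e. it contains no factor of the form $axaxa$ with $a$ a single letter and $x$ a possibly empty word.
   Context: For a finite sequence $\mathbf f$ over $\{-1,1\}$ define $P_\epsilon=\epsilon$ (empty) and $P_{\mathbf f a}=P_{\mathbf f}\ a\ (-P_{\mathbf f}^R)$ for $a\in\{-1,1\}$, where $-x$ negates every entry and $x^R$ is reversal. For an infinite $\mathbf f=f_0f_1\cdots$, $P_{\mathbf f}$ is the unique infinite sequence having every $P_{f_0\cdots f_n}$ as a prefix. A run is a maximal block of consecutive identical entries; the run-length sequence $R_{\mathbf f}$ is the sequence of lengths of the runs of $P_{\mathbf f}$ from left to right (a word over $\{1,2,3\}$). A factor is a contiguous block. *)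

theory Defs
  imports Main "HOL-Library.Sublist" "HOL-Library.Infinite_Set"
begin

definition pm1_list :: "int list \<Rightarrow> bool" where
  "pm1_list f \<longleftrightarrow> set f \<subseteq> {-1, 1}"

definition pm1_seq :: "(nat \<Rightarrow> int) \<Rightarrow> bool" where
  "pm1_seq f \<longleftrightarrow> range f \<subseteq> {-1, 1}"

definition paperfold :: "int list \<Rightarrow> int list" where
  "paperfold f = foldl (\<lambda>p a. p @ [a] @ map uminus (rev p)) [] f"

lemma paperfold_Nil [simp]: "paperfold [] = []"
  by (simp add: paperfold_def)

lemma paperfold_snoc [simp]:
  "paperfold (f @ [a]) = paperfold f @ [a] @ map uminus (rev (paperfold f))"
  by (simp add: paperfold_def)

definition prefix_of_seq :: "'a list \<Rightarrow> (nat \<Rightarrow> 'a) \<Rightarrow> bool" where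
  "prefix_of_seq u p \<longleftrightarrow> (\<forall>i<length u. p i = u ! i)"

definition paperfold_inf :: "(nat \<Rightarrow> int) \<Rightarrow> (nat \<Rightarrow> int)" where
  "paperfold_inf f = (THE p. \<forall>n. prefix_of_seq (paperfold (map f [0..<Suc n])) p)"

lemma length_paperfold: "length (paperfold f) = 2 ^ length f - 1"
proof (induction f rule: rev_induct)
  case (snoc a f)
  have "(1::nat) \<le> 2 ^ length f" by simp
  then show ?case using snoc by simp
qed simp

lemma prefix_paperfold_mono:
  assumes "m \<le> n"
  shows "prefix (paperfold (map f [0..<m])) (paperfold (map f [0..<n]))"
  using assms
proof (induction n rule: dec_induct)
  case (step n)
  have "prefix (paperfold (map f [0..<n])) (paperfold (map f [0..<Suc n]))"
    by simp
  with step.IH show ?case by (rule prefix_order.trans)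
qed simp

lemma less_length_paperfold: "i < length (paperfold (map f [0..<Suc i]))"
proof -
  have "Suc i < 2 ^ Suc i" by (rule less_exp)
  then have "i < 2 ^ Suc i - 1" by linarith
  then show ?thesis by (simp only: length_paperfold length_map length_upt diff_zero)
qed

lemma paperfold_inf_ex1:
  "\<exists>!p. \<forall>n. prefix_of_seq (paperfold (map f [0..<Suc n])) p"
proof -
  define w where "w n = paperfold (map f [0..<Suc n])" for n
  have len: "i < length (w i)" for i
    unfolding w_def by (rule less_length_paperfold)
  have mono: "prefix (w m) (w n)" if "m \<le> n" for m n
    unfolding w_def by (rule prefix_paperfold_mono) (use that in simp)
  have nth_eq: "w m ! i = w n ! i" if "i < length (w m)" "i < length (w n)" for m n i
  proof (cases "m \<le> n")
    case True
    then show ?thesis using mono[of m n] that by (auto simp: prefix_def nth_append)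
  next
    case False
    then show ?thesis using mono[of n m] that by (auto simp: prefix_def nth_append)
  qed
  have "\<exists>!p. \<forall>n. prefix_of_seq (w n) p"
  proof (rule ex1I)
    show "\<forall>n. prefix_of_seq (w n) (\<lambda>i. w i ! i)"
      unfolding prefix_of_seq_def using len nth_eq by blast
  next
    fix p assume "\<forall>n. prefix_of_seq (w n) p"
    then show "p = (\<lambda>i. w i ! i)"
      unfolding prefix_of_seq_def using len by blast
  qed
  then show ?thesis by (simp only: w_def)
qed

lemma prefix_of_seq_paperfold_inf:
  "prefix_of_seq (paperfold (map f [0..<Suc n])) (paperfold_inf f)"
  using theI'[OF paperfold_inf_ex1[of f]] unfolding paperfold_inf_def by blast

lemmas [termination_simp] = length_dropWhile_le less_Suc_eq_le

fun run_lengths :: "'a list \<Rightarrow> nat list" where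
  "run_lengths [] = []"
| "run_lengths (x # xs) =
     Suc (length (takeWhile (\<lambda>y. y = x) xs)) # run_lengths (dropWhile (\<lambda>y. y = x) xs)"

definition run_starts :: "(nat \<Rightarrow> 'a) \<Rightarrow> nat set" where
  "run_starts p = {i. i = 0 \<or> p i \<noteq> p (i - 1)}"

text \<open>
  The \<open>k\<close>-th run ends where the next one begins. This is meaningful only if
  there are infinitely many runs, which \<open>infinite_run_starts_paperfold_inf\<close> below
  provides for the sequences considered here.
\<close>
definition run_lengths_inf :: "(nat \<Rightarrow> 'a) \<Rightarrow> (nat \<Rightarrow> nat)" where
  "run_lengths_inf p k = enumerate (run_starts p) (Suc k) - enumerate (run_starts p) k"

lemma hd_last_paperfold:
  assumes "pm1_seq f"
  shows "paperfold_inf f (2 ^ Suc (Suc n)) = f 0"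
    and "paperfold_inf f (2 ^ Suc (Suc n) - 2) = - f 0"
proof -
  define w where "w n = paperfold (map f [0..<Suc n])" for n
  have len: "length (w n) = 2 ^ Suc n - 1" for n
    unfolding w_def by (simp only: length_paperfold length_map length_upt diff_zero)
  have wS: "w (Suc n) = w n @ [f (Suc n)] @ map uminus (rev (w n))" for n
    unfolding w_def by (simp only: upt_Suc_append map_append list.map paperfold_snoc zero_le)
  have hd: "w n ! 0 = f 0" for n
  proof (induction n)
    case 0
    show ?case by (simp add: w_def paperfold_def)
  next
    case (Suc n)
    have "w n \<noteq> []" using len[of n] less_exp[of "Suc n"] by force
    with Suc show ?case by (simp add: wS nth_append)
  qed
  have pfx: "i < length (w n) \<Longrightarrow> paperfold_inf f i = w n ! i" for n i
    using prefix_of_seq_paperfold_inf[of f n] by (simp add: prefix_of_seq_def w_def)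
  have pos: "0 < length (w n)" for n
    using len[of n] less_exp[of "Suc n"] by linarith
  have L: "length (w (Suc n)) = 2 * length (w n) + 1" for n
    by (simp add: wS)
  have last: "w (Suc n) ! (length (w (Suc n)) - 1) = - f 0" for n
  proof -
    have "w (Suc n) ! (2 * length (w n)) = - (w n ! 0)"
      using pos[of n] by (auto simp: wS nth_append rev_nth nth_Cons')
    then show ?thesis using hd by (simp add: L)
  qed
  show "paperfold_inf f (2 ^ Suc (Suc n) - 2) = - f 0"
  proof -
    have e: "length (w (Suc n)) - 1 = 2 ^ Suc (Suc n) - 2" using len[of "Suc n"] by linarith
    have "paperfold_inf f (length (w (Suc n)) - 1) = w (Suc n) ! (length (w (Suc n)) - 1)"
      by (rule pfx) (use pos[of "Suc n"] in linarith)
    then show ?thesis by (simp only: last flip: e)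
  qed
  show "paperfold_inf f (2 ^ Suc (Suc n)) = f 0"
  proof -
    let ?l = "length (w (Suc n))"
    have e: "2 ^ Suc (Suc n) = ?l + 1"
      using len[of "Suc n"] one_le_power[of "2::nat" "Suc (Suc n)"] by linarith
    have lt: "?l + 1 < length (w (Suc (Suc n)))"
      using pos[of "Suc n"] L[of "Suc n"] by linarith
    have "w (Suc (Suc n)) ! (?l + 1) = - (w (Suc n) ! (?l - 1))"
      using pos[of "Suc n"] by (simp add: wS[of "Suc n"] nth_append rev_nth)
    then have "paperfold_inf f (?l + 1) = f 0"
      using pfx[OF lt] last[of n] by simp
    then show ?thesis by (simp only: e)
  qed
qed

lemma infinite_run_starts_paperfold_inf:
  assumes "pm1_seq f"
  shows "infinite (run_starts (paperfold_inf f))"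
  unfolding infinite_nat_iff_unbounded_le
proof
  fix m :: nat
  let ?p = "paperfold_inf f" and ?N = "2 ^ Suc (Suc m) :: nat"
  have N: "m + 2 < ?N"
    using less_exp[of "Suc (Suc m)"] by simp
  have "f 0 \<in> {-1, 1}" using assms by (auto simp: pm1_seq_def)
  then have "?p ?N \<noteq> ?p (?N - 2)"
    using hd_last_paperfold[OF assms, of m] by auto
  then have "?p ?N \<noteq> ?p (?N - 1) \<or> ?p (?N - 1) \<noteq> ?p (?N - 1 - 1)"
    by (metis diff_diff_left one_add_one)
  then have "?N \<in> run_starts ?p \<or> ?N - 1 \<in> run_starts ?p"
    by (auto simp: run_starts_def)
  moreover have "m \<le> ?N" "m \<le> ?N - 1" using N by linarith+
  ultimately show "\<exists>n\<ge>m. n \<in> run_starts ?p" by blast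
qed

definition factor_of_seq :: "'a list \<Rightarrow> (nat \<Rightarrow> 'a) \<Rightarrow> bool" where
  "factor_of_seq u w \<longleftrightarrow> (\<exists>i. \<forall>j<length u. w (i + j) = u ! j)"

definition is_overlap :: "'a list \<Rightarrow> bool" where
  "is_overlap u \<longleftrightarrow> (\<exists>a x. u = [a] @ x @ [a] @ x @ [a])"

definition overlap_free :: "'a list \<Rightarrow> bool" where
  "overlap_free w \<longleftrightarrow> \<not> (\<exists>u. is_overlap u \<and> sublist u w)"

definition overlap_free_inf :: "(nat \<Rightarrow> 'a) \<Rightarrow> bool" where
  "overlap_free_inf w \<longleftrightarrow> \<not> (\<exists>u. is_overlap u \<and> factor_of_seq u w)"

end

theory Submission
  imports Defs
begin

text \<open>
  Index the folded word from \<open>1\<close>. Its entries satisfy the folding law: those at \<open>2\<^sup>j m\<close> and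
  \<open>2\<^sup>j (m + 2)\<close> are opposite for odd \<open>m\<close>. As the odd-indexed entries alternate, each even-indexed
  entry equals exactly one of its two neighbours, so the \<open>k\<close>-th run starts at \<open>2k\<close> or \<open>2k + 1\<close>. The
  binary sequence \<open>s\<close> recording which one obeys the folding law again. This includes the two ends: the
  law does not constrain the values at \<open>0\<close> and \<open>2\<^sup>n\<close>.

  Run lengths are \<open>2 + s (k + 1) - s k\<close>, so an overlap of period \<open>p\<close> among them makes
  \<open>s (k + p) - s k\<close> constant for \<open>p + 2\<close> consecutive \<open>k\<close>; the constant is \<open>0\<close> because \<open>s\<close> takes only two
  values. If \<open>p\<close> is even, alternation at odd indices gives \<open>4 dvd p\<close>, and passing to the even-indexed
  subsequence halves \<open>p\<close>, leading to an infinite descent. If \<open>p\<close> is odd, the alternation at odd indices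
  is transported to the even ones, contradicting the law at \<open>2m\<close> and \<open>2m + 4\<close> for odd \<open>m\<close>.
\<close>

section \<open>Periods in binary sequences obeying the folding law\<close>

text \<open>For each \<open>j\<close>, the values at the positions of 2-adic valuation exactly
  \<open>j\<close> alternate. The bound \<open>N\<close> serves finite and infinite words
  alike.\<close>

definition folded :: "(nat \<Rightarrow> bool) \<Rightarrow> nat \<Rightarrow> bool" where
  "folded s N \<longleftrightarrow> (\<forall>j m. odd m \<longrightarrow> 2 ^ j * (m + 2) < N \<longrightarrow> s (2 ^ j * (m + 2)) \<noteq> s (2 ^ j * m))"

lemma folded_odd:
  assumes "folded s N" "odd k" "k + 2 < N"
  shows "s (k + 2) \<noteq> s k"
  using assms unfolding folded_def by (metis mult_1 power_0)

text \<open>Doubling raises the 2-adic valuation by one. The new bound is half of \<open>N\<close>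
  rounded up, since \<open>2 * k < N\<close> iff \<open>k < Suc N div 2\<close>.\<close>

lemma folded_half:
  assumes "folded s N"
  shows "folded (\<lambda>k. s (2 * k)) (Suc N div 2)"
  unfolding folded_def
proof (intro allI impI)
  fix j m :: nat
  assume "odd m" "2 ^ j * (m + 2) < Suc N div 2"
  then have "2 ^ Suc j * (m + 2) < N" by simp
  with assms \<open>odd m\<close> have "s (2 ^ Suc j * (m + 2)) \<noteq> s (2 ^ Suc j * m)"
    unfolding folded_def by blast
  then show "s (2 * (2 ^ j * (m + 2))) \<noteq> s (2 * (2 ^ j * m))"
    by (simp only: power_Suc mult.assoc not_False_eq_True)
qed

lemma folded_odd_shift:
  assumes "folded s N" "odd k" "k + 2 * t < N"
  shows "s (k + 2 * t) \<longleftrightarrow> (s k \<longleftrightarrow> even t)"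
  using assms(3)
proof (induction t)
  case (Suc t)
  have "s (k + 2 * t + 2) \<noteq> s (k + 2 * t)"
    using assms Suc.prems by (intro folded_odd[of s N]) auto
  with Suc show ?case by (auto simp: add.assoc)
qed simp

lemma folded_no_even_square:
  assumes "folded s N" "even p" "0 < p" "i + 2 * p \<le> N"
    and "\<And>k. i \<le> k \<Longrightarrow> k < i + p \<Longrightarrow> s (k + p) = s k"
  shows False
  using assms
proof (induction p arbitrary: s N i rule: less_induct)
  case (less p)
  from \<open>even p\<close> obtain q where p: "p = 2 * q" by blast
  have "even q"
  proof -
    \<comment> \<open>The window has at least two positions, hence an odd one; shifting it by
      \<open>2 * q\<close> flips the value exactly if \<open>q\<close> is odd.\<close>
    define k where "k = (if odd i then i else Suc i)"
    have k: "odd k" "i \<le> k" "k < i + p" using \<open>0 < p\<close> p by (auto simp: k_def)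
    then have "s (k + 2 * q) \<longleftrightarrow> (s k \<longleftrightarrow> even q)"
      using less.prems p by (intro folded_odd_shift[of s N]) auto
    with less.prems(5)[OF k(2,3)] p show ?thesis by auto
  qed
  \<comment> \<open>The first even position from \<open>i\<close> on is
    \<open>2 * (Suc i div 2)\<close>, so the halved window starts at
    \<open>Suc i div 2\<close>.\<close>
  show False
  proof (rule less.IH[of q "\<lambda>k. s (2 * k)" "Suc N div 2" "Suc i div 2"])
    show "folded (\<lambda>k. s (2 * k)) (Suc N div 2)" using less.prems(1) by (rule folded_half)
    show "Suc i div 2 + 2 * q \<le> Suc N div 2" using less.prems(4) p by linarith
    fix k assume "Suc i div 2 \<le> k" "k < Suc i div 2 + q"
    then have "s (2 * k + p) = s (2 * k)" using p by (intro less.prems(5)) linarith+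
    then show "s (2 * (k + q)) = s (2 * k)" by (simp add: p)
  qed (use p \<open>0 < p\<close> \<open>even q\<close> in auto)
qed

text \<open>An odd \<open>p\<close> carries even positions to odd ones, so values at distance 2
  differ throughout the window from \<open>i\<close> to \<open>i + 2 * p + 1\<close>. Values at
  distance 4 then agree, which the law forbids at valuation 1.\<close>

lemma folded_no_odd_period:
  assumes s: "folded s N" and "odd p" "i + 2 * p + 1 < N"
    and per: "\<And>k. i \<le> k \<Longrightarrow> k \<le> i + p + 1 \<Longrightarrow> s (k + p) = s k"
  shows False
proof -
  have anti: "s (k + 2) \<noteq> s k" if k: "i \<le> k" "k + 2 \<le> i + 2 * p + 1" for k
  proof (cases "odd k")
    case True
    then show ?thesis using s assms(3) k by (intro folded_odd[of s N]) auto
  next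
    case False
    show ?thesis
    proof (cases "k + 2 \<le> i + p + 1")
      case True
      have "s (k + p + 2) \<noteq> s (k + p)"
        using s \<open>odd p\<close> False True assms(3) by (intro folded_odd[of s N]) auto
      moreover have "s (k + p) = s k" using k True by (intro per) auto
      moreover have "s (k + 2 + p) = s (k + 2)" using k True by (intro per) auto
      ultimately show ?thesis by (simp add: ac_simps)
    next
      case ge: False
      \<comment> \<open>Near the right end the period is used backwards, as \<open>k + p\<close> may
        leave the window.\<close>
      define l where "l = k - p"
      have l: "k = l + p" "i \<le> l" "l + 2 \<le> i + p + 1" using ge k by (auto simp: l_def)
      have "s (l + 2) \<noteq> s l"
        using s \<open>odd p\<close> False l assms(3) by (intro folded_odd[of s N]) auto
      moreover have "s (l + p) = s l" using l by (intro per) auto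
      moreover have "s (l + 2 + p) = s (l + 2)" using l by (intro per) auto
      ultimately show ?thesis using l by (simp add: ac_simps)
    qed
  qed
  show False
  proof (cases "p = 1")
    case True
    have "s (i + 2) = s i"
      using per[of i] per[of "i + 1"] True by simp
    with anti[of i] True show False by simp
  next
    case False
    with \<open>odd p\<close> have "3 \<le> p" by presburger
    \<comment> \<open>The least number from \<open>i\<close> on that is 2 modulo 4, so of valuation
      1. As \<open>k \<le> i + 3\<close>, the position \<open>k + 4\<close> lies in the window once
      \<open>3 \<le> p\<close>.\<close>
    define k where "k = 2 * (2 * ((i + 1) div 4) + 1)"
    have k: "i \<le> k" "k \<le> i + 3" unfolding k_def by presburger+
    have "2 ^ 1 * (2 * ((i + 1) div 4) + 1 + 2) < N"
      using k \<open>3 \<le> p\<close> assms(3) unfolding k_def by simp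
    with s have "s (2 ^ 1 * (2 * ((i + 1) div 4) + 1 + 2)) \<noteq> s (2 ^ 1 * (2 * ((i + 1) div 4) + 1))"
      unfolding folded_def by (metis even_add even_mult_iff even_numeral odd_one)
    moreover have "2 ^ 1 * (2 * ((i + 1) div 4) + 1 + 2) = k + 4"
      "2 ^ 1 * (2 * ((i + 1) div 4) + 1) = k" by (simp_all add: k_def)
    ultimately have "s (k + 4) \<noteq> s k" by metis
    moreover have "s (k + 2) \<noteq> s k" "s (k + 2 + 2) \<noteq> s (k + 2)"
      using k \<open>3 \<le> p\<close> by (intro anti; simp)+
    moreover have "k + 2 + 2 = k + 4" by simp
    ultimately show False by metis
  qed
qed

text \<open>
  Run starts are positions counted from \<open>0\<close>; the truncated subtraction is harmless if \<open>s 0\<close> holds.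
\<close>
definition run_start :: "(nat \<Rightarrow> bool) \<Rightarrow> nat \<Rightarrow> nat" where
  "run_start s k = 2 * k - of_bool (\<not> s k)"

lemma strict_mono_run_start:
  assumes "s 0"
  shows "strict_mono (run_start s)"
  unfolding strict_mono_Suc_iff run_start_def using assms by (auto simp: of_bool_def)

lemma folded_runs_no_overlap:
  assumes s: "folded s N" "s 0" and "0 < p" "i + 2 * p + 1 < N"
    and per: "\<And>k. i \<le> k \<Longrightarrow> k \<le> i + p \<Longrightarrow>
      run_start s (Suc (k + p)) - run_start s (k + p) = run_start s (Suc k) - run_start s k"
  shows False
proof -
  define c where "c k = int (of_bool (s k))" for k
  have b: "int (run_start s k) = 2 * int k - 1 + c k" for k
    using \<open>s 0\<close> by (cases "k = 0") (auto simp: run_start_def c_def of_bool_def)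
  have d: "int (run_start s (Suc k) - run_start s k) = 2 + c (Suc k) - c k" for k
    using strict_monoD[OF strict_mono_run_start[of s, OF \<open>s 0\<close>], of k "Suc k"]
    by (simp add: of_nat_diff b)
  have step: "c (Suc k + p) - c (Suc k) = c (k + p) - c k" if "i \<le> k" "k \<le> i + p" for k
    using arg_cong[OF per[OF that], of int] unfolding d by simp
  have const: "t \<le> p + 1 \<Longrightarrow> c (i + t + p) - c (i + t) = c (i + p) - c i" for t
  proof (induction t)
    case (Suc t)
    then show ?case using step[of "i + t"] by simp
  qed simp
  have c01: "c k = 0 \<or> c k = 1" for k by (auto simp: c_def)
  \<comment> \<open>The values at \<open>i\<close>, \<open>i + p\<close> and
    \<open>i + p + p\<close> form an arithmetic progression within 0 and 1, so its difference is
    0.\<close>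
  have "c (i + p) = c i"
    using const[of p] c01[of i] c01[of "i + p"] c01[of "i + p + p"] by auto
  then have "c (k + p) = c k" if "i \<le> k" "k \<le> i + p + 1" for k
    using const[of "k - i"] that by simp
  then have eq: "s (k + p) = s k" if "i \<le> k" "k \<le> i + p + 1" for k
    using that unfolding c_def by (metis of_bool_eq_iff of_nat_eq_iff)
  show False
  proof (cases "even p")
    case True
    show False
      by (rule folded_no_even_square[OF s(1) True \<open>0 < p\<close>, of i]) (use assms(4) eq in auto)
  next
    case False
    show False
      by (rule folded_no_odd_period[OF s(1) False, of i]) (use assms(4) eq in auto)
  qed
qed

section \<open>Overlaps as periods, run lengths as differences of run starts\<close>

text \<open>Dropping the first \<open>p = Suc (length x)\<close> letters of \<open>a x a x a\<close>
  leaves \<open>a x a\<close>, a prefix of the whole.\<close>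

lemma is_overlapD:
  assumes "is_overlap u"
  obtains p where "0 < p" "length u = 2 * p + 1" "\<And>j. j \<le> p \<Longrightarrow> u ! (j + p) = u ! j"
proof -
  from assms obtain a x where u: "u = [a] @ x @ [a] @ x @ [a]"
    unfolding is_overlap_def by blast
  show thesis
  proof (rule that[of "Suc (length x)"])
    fix j assume "j \<le> Suc (length x)"
    have "u ! (j + Suc (length x)) = ([a] @ x @ [a]) ! j"
      using nth_append_length_plus[of "[a] @ x" "[a] @ x @ [a]" j] by (simp add: u add.commute)
    also have "\<dots> = (([a] @ x @ [a]) @ x @ [a]) ! j"
      by (rule nth_append_left[symmetric]) (use \<open>j \<le> _\<close> in simp)
    finally show "u ! (j + Suc (length x)) = u ! j" by (simp add: u)
  qed (simp_all add: u)
qed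

lemma run_lengths_replicate_append:
  assumes "0 < d" "ys = [] \<or> hd ys \<noteq> x"
  shows "run_lengths (replicate d x @ ys) = d # run_lengths ys"
proof -
  from assms(1) obtain e where d: "d = Suc e" by (cases d) auto
  have "takeWhile (\<lambda>y. y = x) ys = []" "dropWhile (\<lambda>y. y = x) ys = ys"
    using assms(2) by (cases ys; simp)+
  moreover have "takeWhile (\<lambda>y. y = x) (replicate e x @ ys) = replicate e x @ takeWhile (\<lambda>y. y = x) ys"
    "dropWhile (\<lambda>y. y = x) (replicate e x @ ys) = dropWhile (\<lambda>y. y = x) ys"
    by (rule takeWhile_append2 dropWhile_append2; simp)+
  ultimately show ?thesis by (simp add: d)
qed

text \<open>Runs are peeled off one at a time, by induction from \<open>K\<close> downwards. The
  value \<open>b K\<close> is not a run start but the end of the last run.\<close>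

lemma run_lengths_eq_diffs:
  assumes b: "strict_mono b" "b 0 = 0" "b K = length xs"
    and change: "\<And>i. 0 < i \<Longrightarrow> i < length xs \<Longrightarrow> xs ! i \<noteq> xs ! (i - 1) \<longleftrightarrow> i \<in> range b"
  shows "run_lengths xs = map (\<lambda>k. b (Suc k) - b k) [0..<K]"
proof -
  have "run_lengths (drop (b k) xs) = map (\<lambda>k. b (Suc k) - b k) [k..<K]" if "k \<le> K" for k
    using that
  proof (induction k rule: inc_induct)
    case base
    then show ?case by (simp add: b)
  next
    case (step k)
    have lt: "b k < b (Suc k)" using b(1) by (simp add: strict_mono_less)
    have le: "b (Suc k) \<le> length xs" using b step by (metis Suc_leI strict_mono_less_eq)
    have const: "b k + t < b (Suc k) \<Longrightarrow> xs ! (b k + t) = xs ! b k" for t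
    proof (induction t)
      case (Suc t)
      have "b k + Suc t \<notin> range b"
      proof
        assume "b k + Suc t \<in> range b"
        then obtain l where "b k + Suc t = b l" by blast
        with Suc.prems have "b k < b l" "b l < b (Suc k)" by auto
        with b(1) show False by (simp add: strict_mono_less)
      qed
      with change[of "b k + Suc t"] Suc le show ?case by simp
    qed simp
    have split: "drop (b k) xs = replicate (b (Suc k) - b k) (xs ! b k) @ drop (b (Suc k)) xs"
    proof (rule nth_equalityI)
      fix j assume j: "j < length (drop (b k) xs)"
      show "drop (b k) xs ! j = (replicate (b (Suc k) - b k) (xs ! b k) @ drop (b (Suc k)) xs) ! j"
        using j lt le const[of j] by (auto simp: nth_append add.commute)
    qed (use lt le in simp)
    have "drop (b (Suc k)) xs = [] \<or> hd (drop (b (Suc k)) xs) \<noteq> xs ! b k"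
    proof (cases "b (Suc k) < length xs")
      case True
      then have "xs ! b (Suc k) \<noteq> xs ! (b (Suc k) - 1)"
        using change[of "b (Suc k)"] lt by auto
      moreover have "xs ! (b (Suc k) - 1) = xs ! b k"
        using const[of "b (Suc k) - 1 - b k"] lt by simp
      ultimately show ?thesis using True by (simp add: hd_drop_conv_nth)
    qed simp
    then have "run_lengths (drop (b k) xs) = (b (Suc k) - b k) # run_lengths (drop (b (Suc k)) xs)"
      using lt unfolding split by (intro run_lengths_replicate_append) auto
    with step show ?case by (simp add: upt_conv_Cons)
  qed
  from this[of 0] show ?thesis by (simp add: b)
qed

lemma enumerate_range:
  fixes b :: "nat \<Rightarrow> nat"
  assumes "strict_mono b"
  shows "enumerate (range b) = b"
proof
  have inf: "infinite (range b)"
    using assms by (simp add: range_inj_infinite strict_mono_imp_inj_on)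
  fix n show "enumerate (range b) n = b n"
  proof (induction n)
    case 0
    show ?case unfolding enumerate_0
      by (rule Least_equality) (use assms in \<open>auto simp: strict_mono_less_eq\<close>)
  next
    case (Suc n)
    show ?case unfolding enumerate_Suc''[OF inf] Suc
      by (rule Least_equality)
        (use assms in \<open>auto simp: strict_mono_less strict_mono_less_eq Suc_le_eq\<close>)
  qed
qed

section \<open>The folding law for paperfolding words\<close>

text \<open>Folding is defined by appending instructions; this is the recursion at the front.
  Counted from 1, the even positions are mapped to themselves by the reflection in the middle, so
  each fold respects them.\<close>

lemma paperfold_Cons_even:
  assumes "0 < i" "i < 2 ^ length f"
  shows "paperfold (a # f) ! (2 * i - 1) = paperfold f ! (i - 1)"
  using assms
proof (induction f arbitrary: i rule: rev_induct)
  case (snoc c f)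
  let ?n = "2 ^ length f :: nat"
  have len: "length (paperfold f) = ?n - 1" "length (paperfold (a # f)) = 2 * ?n - 1"
    by (simp_all add: length_paperfold)
  have eq: "paperfold (a # f @ [c]) = paperfold (a # f) @ [c] @ map uminus (rev (paperfold (a # f)))"
    using paperfold_snoc[of "a # f" c] by simp
  consider "i < ?n" | "i = ?n" | "?n < i" by linarith
  then show ?case
  proof cases
    case 1
    then show ?thesis using snoc.IH[of i] snoc.prems
      by (simp add: eq nth_append len)
  next
    case 2
    then show ?thesis by (simp add: eq nth_append len)
  next
    case 3
    \<comment> \<open>The mirror image of \<open>i\<close> in the middle position \<open>?n\<close>,
      counted from 1; mirror images carry opposite entries.\<close>
    define l where "l = 2 * ?n - i"
    have i: "i = 2 * ?n - l" "0 < l" "l < ?n" using 3 snoc.prems by (auto simp: l_def)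
    have "paperfold (a # f @ [c]) ! (2 * i - 1) = - paperfold (a # f) ! (2 * l - 1)"
    proof -
      have "2 * i - 1 = (2 * ?n - 1) + Suc (2 * ?n - 1 - Suc (2 * l - 1))" using i by linarith
      moreover have "2 * ?n - 1 - Suc (2 * ?n - 1 - Suc (2 * l - 1)) = 2 * l - 1" using i by linarith
      ultimately show ?thesis
        using i by (simp only: eq nth_append_length_plus flip: len) (simp add: rev_nth)
    qed
    moreover have "paperfold (f @ [c]) ! (i - 1) = - paperfold f ! (l - 1)"
    proof -
      have "i - 1 = (?n - 1) + Suc (?n - 1 - Suc (l - 1))" using i by linarith
      moreover have "?n - 1 - Suc (?n - 1 - Suc (l - 1)) = l - 1" using i by linarith
      ultimately show ?thesis
        using i by (simp only: paperfold_snoc nth_append_length_plus flip: len) (simp add: rev_nth)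
    qed
    ultimately show ?thesis using snoc.IH[of l] i by simp
  qed
qed simp

text \<open>The reflection changes the parity of \<open>i\<close> and the fold changes the sign, so
  the alternation continues across the middle.\<close>

lemma paperfold_Cons_odd:
  assumes "i < 2 ^ length f"
  shows "paperfold (a # f) ! (2 * i) = (if even i then a else - a)"
  using assms
proof (induction f arbitrary: i rule: rev_induct)
  case Nil
  then show ?case by (simp add: paperfold_def)
next
  case (snoc c f)
  let ?n = "2 ^ length f :: nat"
  have len: "length (paperfold (a # f)) = 2 * ?n - 1"
    by (simp add: length_paperfold)
  have eq: "paperfold (a # f @ [c]) = paperfold (a # f) @ [c] @ map uminus (rev (paperfold (a # f)))"
    using paperfold_snoc[of "a # f" c] by simp
  show ?case
  proof (cases "i < ?n")
    case True
    moreover have "2 * i < 2 * ?n - 1" using True by linarith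
    ultimately show ?thesis using snoc.IH[of i] by (simp add: eq nth_append len)
  next
    case False
    define l where "l = 2 * ?n - 1 - i"
    have i: "i = 2 * ?n - 1 - l" "l < ?n" using False snoc.prems by (auto simp: l_def)
    have "2 * i = (2 * ?n - 1) + Suc (2 * ?n - 1 - Suc (2 * l))" using i by linarith
    moreover have "2 * ?n - 1 - Suc (2 * ?n - 1 - Suc (2 * l)) = 2 * l" using i by linarith
    ultimately have "paperfold (a # f @ [c]) ! (2 * i) = - paperfold (a # f) ! (2 * l)"
      using i by (simp only: eq nth_append_length_plus flip: len) (simp add: rev_nth)
    moreover have "even i \<longleftrightarrow> odd l" using i by auto
    ultimately show ?thesis using snoc.IH[of l] i by auto
  qed
qed

text \<open>Each leading instruction removed halves the positions; after \<open>j\<close> of them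
  they are odd, where the entries alternate.\<close>

lemma paperfold_folded:
  assumes "odd m" "2 ^ j * (m + 2) < 2 ^ length f"
  shows "paperfold f ! (2 ^ j * (m + 2) - 1) = - paperfold f ! (2 ^ j * m - 1)"
  using assms
proof (induction j arbitrary: f)
  case 0
  then obtain a g where f: "f = a # g" by (cases f) auto
  from \<open>odd m\<close> obtain t where m: "m = 2 * t + 1" by (rule oddE)
  show ?case
    using 0 paperfold_Cons_odd[of t g a] paperfold_Cons_odd[of "Suc t" g a] by (simp add: f m)
next
  case (Suc j)
  then obtain a g where f: "f = a # g" by (cases f) auto
  have "0 < m" using \<open>odd m\<close> by (rule odd_pos)
  then show ?case
    using Suc paperfold_Cons_even[of "2 ^ j * m" g a] paperfold_Cons_even[of "2 ^ j * (m + 2)" g a]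
    by (simp add: f mult.assoc)
qed

lemma set_paperfold:
  assumes "pm1_list f"
  shows "set (paperfold f) \<subseteq> {-1, 1}"
  using assms by (induction f rule: rev_induct) (auto simp: pm1_list_def)

text \<open>
  The folding law is stated for words indexed from \<open>1\<close>, whereas \<open>p\<close> is indexed from \<open>0\<close>.
\<close>
definition folded_word :: "(nat \<Rightarrow> int) \<Rightarrow> nat \<Rightarrow> bool" where
  "folded_word p M \<longleftrightarrow> (\<forall>i<M - 1. p i \<in> {-1, 1}) \<and>
    (\<forall>j m. odd m \<longrightarrow> 2 ^ j * (m + 2) < M \<longrightarrow> p (2 ^ j * (m + 2) - 1) = - p (2 ^ j * m - 1))"

lemma folded_word_paperfold:
  assumes "pm1_list f"
  shows "folded_word ((!) (paperfold f)) (2 ^ length f)"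
  using set_paperfold[OF assms] paperfold_folded[of _ _ f] unfolding folded_word_def
  by (metis length_paperfold nth_mem subsetD)

text \<open>Below \<open>M\<close> the law concerns finitely many entries, all within a finite
  paperfolding prefix.\<close>

lemma folded_word_paperfold_inf:
  assumes "pm1_seq f"
  shows "folded_word (paperfold_inf f) M"
proof -
  define w where "w = paperfold (map f [0..<Suc M])"
  have len: "length w = 2 ^ Suc M - 1"
    unfolding w_def by (simp only: length_paperfold length_map length_upt diff_zero)
  have M: "M < 2 ^ Suc M" using less_exp[of "Suc M"] by linarith
  have w: "paperfold_inf f i = w ! i" if "i < M" for i
    using prefix_of_seq_paperfold_inf[of f M] that len M
    unfolding prefix_of_seq_def w_def[symmetric] by auto
  have "pm1_list (map f [0..<Suc M])"
    using assms by (auto simp: pm1_list_def pm1_seq_def simp del: upt_Suc)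
  from folded_word_paperfold[OF this] have fw: "folded_word ((!) w) (2 ^ Suc M)"
    by (simp only: w_def length_map length_upt diff_zero)
  show ?thesis unfolding folded_word_def
  proof (intro conjI allI impI)
    fix i assume "i < M - 1"
    then show "paperfold_inf f i \<in> {-1, 1}"
      using fw M w[of i] unfolding folded_word_def by auto
  next
    fix j m :: nat assume *: "odd m" "2 ^ j * (m + 2) < M"
    then have "w ! (2 ^ j * (m + 2) - 1) = - w ! (2 ^ j * m - 1)"
      using fw M unfolding folded_word_def by (meson less_trans)
    moreover have "2 ^ j * m - 1 < M" using * by (simp add: algebra_simps)
    ultimately show "paperfold_inf f (2 ^ j * (m + 2) - 1) = - paperfold_inf f (2 ^ j * m - 1)"
      using * by (simp add: w)
  qed
qed

section \<open>Run starts of folded words\<close>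

text \<open>In a folded word, run \<open>k\<close> starts at \<open>2 * k\<close> in this case and
  at \<open>2 * k - 1\<close> otherwise, counted from 0. At \<open>k = 0\<close> the value is a
  convention that makes the first run start at 0.\<close>

definition late_start :: "(nat \<Rightarrow> int) \<Rightarrow> nat \<Rightarrow> bool" where
  "late_start p k \<longleftrightarrow> k = 0 \<or> p (2 * k - 1) = p (2 * k - 2)"

lemma folded_word_odd:
  assumes "folded_word p M" "2 * k + 3 < M"
  shows "p (2 * k + 2) = - p (2 * k)"
proof -
  have "odd (2 * k + 1) \<and> 2 ^ 0 * (2 * k + 1 + 2) < M" using assms(2) by simp
  then have "p (2 ^ 0 * (2 * k + 1 + 2) - 1) = - p (2 ^ 0 * (2 * k + 1) - 1)"
    using assms(1) unfolding folded_word_def by blast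
  moreover have "2 ^ 0 * (2 * k + 1 + 2) - 1 = 2 * k + 2" "2 ^ 0 * (2 * k + 1) - 1 = 2 * k" by simp_all
  ultimately show ?thesis by (simp only:)
qed

lemma folded_word_odd_shift:
  assumes "folded_word p M" "2 * (k + 2 * t) + 1 < M"
  shows "p (2 * (k + 2 * t)) = p (2 * k)"
  using assms(2)
proof (induction t)
  case (Suc t)
  have "p (2 * (k + 2 * t) + 2) = - p (2 * (k + 2 * t))"
    using Suc.prems by (intro folded_word_odd[OF assms(1)]) simp
  moreover have "p (2 * (k + 2 * t + 1) + 2) = - p (2 * (k + 2 * t + 1))"
    using Suc.prems by (intro folded_word_odd[OF assms(1)]) simp
  moreover have "2 * (k + 2 * t + 1) = 2 * (k + 2 * t) + 2"
    "2 * (k + 2 * Suc t) = 2 * (k + 2 * t + 1) + 2" by simp_all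
  ultimately show ?case using Suc by simp
qed simp

text \<open>Tying \<open>s\<close> to \<open>late_start\<close> only for \<open>2 * k < M\<close>
  leaves its value at the end of a finite word free.\<close>

lemma folded_word_run_starts:
  assumes "folded_word p M" "0 < i" "i + 1 < M"
    and s: "\<And>k. 2 * k < M \<Longrightarrow> s k \<longleftrightarrow> late_start p k"
  shows "p i \<noteq> p (i - 1) \<longleftrightarrow> i \<in> range (run_start s)"
proof -
  have R: "i \<in> range (run_start s) \<longleftrightarrow> (if odd i then \<not> s (Suc i div 2) else s (i div 2))"
  proof
    assume "i \<in> range (run_start s)"
    then obtain k where k: "i = run_start s k" by blast
    show "if odd i then \<not> s (Suc i div 2) else s (i div 2)"
    proof (cases "s k")
      case True
      then show ?thesis using k by (simp add: run_start_def)
    next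
      case False
      then have "Suc i = 2 * k" using k \<open>0 < i\<close> by (simp add: run_start_def)
      moreover from this have "odd i" by presburger
      ultimately show ?thesis using False by simp
    qed
  next
    assume *: "if odd i then \<not> s (Suc i div 2) else s (i div 2)"
    have "i = run_start s (Suc i div 2)"
    proof (cases "odd i")
      case True
      then obtain k where "i = 2 * k + 1" by (rule oddE)
      with * show ?thesis by (simp add: run_start_def)
    next
      case False
      then obtain k where "i = 2 * k" by blast
      with * show ?thesis by (simp add: run_start_def)
    qed
    then show "i \<in> range (run_start s)" by (rule range_eqI)
  qed
  show ?thesis
  proof (cases "odd i")
    case True
    then obtain k where i: "i = 2 * k + 1" by (rule oddE)
    then show ?thesis using s[of "Suc k"] assms(3) R by (simp add: late_start_def)
  next
    case False
    then obtain l where "i = 2 * l" by blast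
    with \<open>0 < i\<close> obtain k where k: "i = 2 * Suc k" by (cases l) auto
    \<comment> \<open>The entry at \<open>2 * k + 1\<close> lies between opposite neighbours, so it
      differs from exactly one of them.\<close>
    have "p (2 * k + 2) = - p (2 * k)"
      using folded_word_odd[OF assms(1), of k] assms(3) k by simp
    moreover have "p (2 * k) \<in> {-1, 1}" "p (2 * k + 1) \<in> {-1, 1}"
      using assms(1,3) k unfolding folded_word_def by auto
    moreover have "s (Suc k) \<longleftrightarrow> p (2 * k + 1) = p (2 * k)"
      using s[of "Suc k"] assms(3) k by (simp add: late_start_def)
    moreover have "p i = p (2 * k + 2)" "p (i - 1) = p (2 * k + 1)" using k by simp_all
    moreover have "i \<in> range (run_start s) \<longleftrightarrow> s (Suc k)" using R k by simp
    ultimately show ?thesis by auto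
  qed
qed

text \<open>Between \<open>k = 2 ^ j * m\<close> and \<open>k + 2 * 2 ^ j\<close>, the entry at
  \<open>2 * k - 1\<close> changes sign by the law at level \<open>Suc j\<close>. Its left neighbour
  undergoes \<open>2 * 2 ^ j\<close> alternations, an even number, and is unchanged. So equality of
  the two is reversed.\<close>

lemma folded_late_start:
  assumes p: "folded_word p M" and "2 * N \<le> M + 1"
    and s: "\<And>k. 2 * k < M \<Longrightarrow> s k \<longleftrightarrow> late_start p k"
  shows "folded s N"
  unfolding folded_def
proof (intro allI impI)
  fix j m :: nat
  assume m: "odd m" and lt: "2 ^ j * (m + 2) < N"
  define k where "k = 2 ^ j * m"
  have k: "0 < k" "2 ^ j * (m + 2) = k + 2 * 2 ^ j"
    using m by (auto simp: k_def algebra_simps odd_pos)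
  have bound: "2 * (k + 2 * 2 ^ j) < M" using lt assms(2) k by simp
  have "2 ^ Suc j * (m + 2) < M" using bound k by simp
  with p m have "p (2 ^ Suc j * (m + 2) - 1) = - p (2 ^ Suc j * m - 1)"
    unfolding folded_word_def by blast
  then have *: "p (2 * (k + 2 * 2 ^ j) - 1) = - p (2 * k - 1)"
    by (simp only: power_Suc mult.assoc k k_def[symmetric])
  have "p (2 * (k - 1 + 2 * 2 ^ j)) = p (2 * (k - 1))"
    using k bound by (intro folded_word_odd_shift[OF p]) simp
  moreover have "2 * (k - 1 + 2 * 2 ^ j) = 2 * (k + 2 * 2 ^ j) - 2" "2 * (k - 1) = 2 * k - 2"
    using k by simp_all
  ultimately have **: "p (2 * (k + 2 * 2 ^ j) - 2) = p (2 * k - 2)" by (simp only:)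
  have "p (2 * k - 1) \<in> {-1, 1}" "p (2 * k - 2) \<in> {-1, 1}"
    using p k bound unfolding folded_word_def by auto
  with * ** have "late_start p (k + 2 * 2 ^ j) \<noteq> late_start p k"
    using k(1) unfolding late_start_def by force
  moreover have "2 * k < M" using bound by simp
  ultimately show "s (2 ^ j * (m + 2)) \<noteq> s (2 ^ j * m)"
    using bound s[of k] s[of "k + 2 * 2 ^ j"] unfolding k(2) k_def[symmetric] by simp
qed

text \<open>The one position gained is \<open>2 ^ n\<close>, which has no odd divisor
  \<open>m + 2 \<ge> 3\<close>, so the law does not constrain the value there.\<close>

lemma folded_Suc_power2:
  assumes "folded s (2 ^ n)"
  shows "folded s (Suc (2 ^ n))"
  unfolding folded_def
proof (intro allI impI)
  fix j m :: nat
  assume m: "odd m" and lt: "2 ^ j * (m + 2) < Suc (2 ^ n)"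
  have "2 ^ j * (m + 2) \<noteq> 2 ^ n"
  proof
    assume "2 ^ j * (m + 2) = 2 ^ n"
    then have "m + 2 dvd 2 ^ n" by (metis dvd_triv_right)
    moreover have "coprime (m + 2) (2 ^ n)" using m by simp
    ultimately have "m + 2 dvd 1" by (metis coprime_common_divisor dvd_refl)
    then show False by simp
  qed
  with m lt assms show "s (2 ^ j * (m + 2)) \<noteq> s (2 ^ j * m)"
    unfolding folded_def by simp
qed

section \<open>Overlap-freeness for finite and infinite instruction sequences\<close>

lemma overlap_free_run_lengths_paperfold:
  assumes "pm1_list f"
  shows "overlap_free (run_lengths (paperfold f))"
proof (cases f)
  case Nil
  then show ?thesis by (auto simp: overlap_free_def is_overlap_def)
next
  case (Cons a g)
  let ?K = "2 ^ length g :: nat"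
  have len: "length (paperfold f) = 2 * ?K - 1" by (simp add: length_paperfold Cons)
  have p: "folded_word ((!) (paperfold f)) (2 * ?K)"
    using folded_word_paperfold[OF assms] by (simp add: Cons)
  \<comment> \<open>The free value at \<open>?K\<close> is set to false, so that
    \<open>run_start s ?K = 2 * ?K - 1\<close> is the length of the word, where its last run
    ends.\<close>
  define s where "s k \<longleftrightarrow> k \<noteq> ?K \<and> late_start ((!) (paperfold f)) k" for k
  have s0: "s 0" by (simp add: s_def late_start_def)
  have sK: "s k \<longleftrightarrow> late_start ((!) (paperfold f)) k" if "2 * k < 2 * ?K" for k
    using that by (simp add: s_def)
  have fold: "folded s (Suc ?K)"
    by (rule folded_Suc_power2) (rule folded_late_start[OF p _ sK]; simp)
  have R: "run_lengths (paperfold f) = map (\<lambda>k. run_start s (Suc k) - run_start s k) [0..<?K]"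
  proof (rule run_lengths_eq_diffs)
    show "strict_mono (run_start s)" using s0 by (rule strict_mono_run_start)
    show "run_start s 0 = 0" by (simp add: run_start_def)
    show "run_start s ?K = length (paperfold f)" by (simp add: run_start_def s_def len)
    show "paperfold f ! i \<noteq> paperfold f ! (i - 1) \<longleftrightarrow> i \<in> range (run_start s)"
      if "0 < i" "i < length (paperfold f)" for i
      using that len by (intro folded_word_run_starts[OF p _ _ sK]) auto
  qed
  show ?thesis unfolding overlap_free_def
  proof safe
    fix u assume "is_overlap u" "sublist u (run_lengths (paperfold f))"
    from is_overlapD[OF this(1)] obtain q where
      q: "0 < q" "length u = 2 * q + 1" "\<And>j. j \<le> q \<Longrightarrow> u ! (j + q) = u ! j" by blast
    obtain v w where vw: "run_lengths (paperfold f) = v @ u @ w"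
      using \<open>sublist u _\<close> by (auto simp: sublist_def)
    let ?i = "length v"
    have K: "length v + length u + length w = ?K"
      using arg_cong[OF vw, of length] unfolding R by simp
    have d: "run_start s (Suc (?i + j)) - run_start s (?i + j) = u ! j" if "j < length u" for j
    proof -
      have "run_lengths (paperfold f) ! (?i + j) = u ! j" using that vw by (simp add: nth_append)
      moreover have "?i + j < ?K" using that K by simp
      ultimately show ?thesis unfolding R by simp
    qed
    show False
    proof (rule folded_runs_no_overlap[OF fold s0 q(1)])
      show "?i + 2 * q + 1 < Suc ?K" using K q(2) by simp
      fix k assume "?i \<le> k" "k \<le> ?i + q"
      then show "run_start s (Suc (k + q)) - run_start s (k + q) = run_start s (Suc k) - run_start s k"
        using d[of "k - ?i"] d[of "k - ?i + q"] q(2) q(3)[of "k - ?i"] by simp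
    qed
  qed
qed

lemma overlap_free_run_lengths_paperfold_inf:
  assumes "pm1_seq f"
  shows "overlap_free_inf (run_lengths_inf (paperfold_inf f))"
proof -
  let ?p = "paperfold_inf f"
  note p = folded_word_paperfold_inf[OF assms]
  define s where "s = late_start ?p"
  have s0: "s 0" by (simp add: s_def late_start_def)
  have s: "s k \<longleftrightarrow> late_start ?p k" for k by (simp add: s_def)
  have "i \<in> run_starts ?p \<longleftrightarrow> i \<in> range (run_start s)" for i
  proof (cases "i = 0")
    case True
    have "run_start s 0 = 0" by (simp add: run_start_def)
    then have "0 \<in> range (run_start s)" by (metis rangeI)
    then show ?thesis by (simp add: True run_starts_def)
  next
    case False
    then show ?thesis
      using folded_word_run_starts[OF p[of "i + 2"] _ _ s, of i] by (simp add: run_starts_def)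
  qed
  then have "run_starts ?p = range (run_start s)" by blast
  then have R: "run_lengths_inf ?p k = run_start s (Suc k) - run_start s k" for k
    unfolding run_lengths_inf_def by (simp only: enumerate_range[OF strict_mono_run_start[of s, OF s0]])
  show ?thesis unfolding overlap_free_inf_def
  proof safe
    fix u assume "is_overlap u" "factor_of_seq u (run_lengths_inf ?p)"
    from is_overlapD[OF this(1)] obtain q where
      q: "0 < q" "length u = 2 * q + 1" "\<And>j. j \<le> q \<Longrightarrow> u ! (j + q) = u ! j" by blast
    obtain i where "\<forall>j<length u. run_lengths_inf ?p (i + j) = u ! j"
      using \<open>factor_of_seq u _\<close> unfolding factor_of_seq_def by blast
    then have d: "run_start s (Suc (i + j)) - run_start s (i + j) = u ! j" if "j < length u" for j
      using that by (simp add: R)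
    \<comment> \<open>The overlap involves \<open>s\<close> up to index
      \<open>i + 2 * q + 1\<close>; the law is available for every bound.\<close>
    let ?N = "i + 2 * q + 2"
    have fold: "folded s ?N"
      by (rule folded_late_start[OF p[of "2 * ?N"] _ s]) simp
    show False
    proof (rule folded_runs_no_overlap[OF fold s0 q(1)])
      fix k assume "i \<le> k" "k \<le> i + q"
      then show "run_start s (Suc (k + q)) - run_start s (k + q) = run_start s (Suc k) - run_start s k"
        using d[of "k - i"] d[of "k - i + q"] q(2) q(3)[of "k - i"] by simp
    qed simp
  qed
qed

theorem theorem5:
  shows "(\<forall>f :: int list. pm1_list f \<longrightarrow> overlap_free (run_lengths (paperfold f))) \<and>
         (\<forall>f :: nat \<Rightarrow> int. pm1_seq f \<longrightarrow> overlap_free_inf (run_lengths_inf (paperfold_inf f)))"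
  using overlap_free_run_lengths_paperfold overlap_free_run_lengths_paperfold_inf by blast

end
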